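(* Let $A$ be a bounded linear operator on $\ell^2$ given by an (infinite) complex diagonal matrix with respect to the standard orthonormal basis. Then its numerical range is the convex hull of its Berezin range, i.e., $$W(A)=\left\{\sum_{i=1}^{\infty}|\lambda_i|^2\widetilde{A}(i)\,:\,\lambda_i\in\mathbb{C}\ (i\ge1),\ \sum_{i=1}^{\infty}|\lambda_i|^2=1\right\}.$$
   Context: $\ell^2$ is viewed as a reproducing kernel Hilbert space of functions on $\{1,2,3,\dots\}$ with its standard inner product; its reproducing kernel at $i$ is the standard basis vector $e_i$. For a bounded operator $A$ on $\ell^2$, the Berezin transform is $\widetilde{A}(i)=\langle Ae_i,e_i\rangle$ for $i\ge1$, the Berezin range is $\mathrm{Ber}(A)=\{\widetilde{A}(i):i\ge1\}$, and the numerical range is $W(A)=\{\langle Au,u\rangle:u\in\ell^2,\ \|u\|=1\}$. *)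

theory Defs
  imports "HOL-Analysis.Analysis"
begin

text \<open>
  The elements of \<open>ell2\<close> are the square-summable complex functions on \<open>{1,2,3,\<dots>}\<close>. Such a function is
  represented by its extension to \<open>nat\<close> with value \<open>0\<close> at the unused index \<open>0\<close>.
\<close>

typedef ell2 = "{x :: nat \<Rightarrow> complex. x 0 = 0 \<and> (\<lambda>i. (cmod (x i))\<^sup>2) summable_on {1..}}"
  morphisms coord Abs_ell2
  by (rule exI[of _ "\<lambda>_. 0"]) simp

setup_lifting type_definition_ell2

lemma coord_0 [simp]: "coord x 0 = 0"
  using coord[of x] by simp

lemma coord_square_summable: "(\<lambda>i. (cmod (coord x i))\<^sup>2) summable_on {1..}"
  using coord[of x] by simp

lemma ell2_eqI: "(\<And>i. i \<ge> 1 \<Longrightarrow> coord x i = coord y i) \<Longrightarrow> x = y"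
  by (metis coord_0 coord_inject ext less_one linorder_not_less)

lemma square_summable_scale:
  fixes x :: "nat \<Rightarrow> complex"
  assumes "(\<lambda>i. (cmod (x i))\<^sup>2) summable_on S"
  shows "(\<lambda>i. (cmod (c * x i))\<^sup>2) summable_on S"
  using summable_on_cmult_right[OF assms, of "(cmod c)\<^sup>2"]
  by (simp add: norm_mult power_mult_distrib)

lemma square_summable_add:
  fixes x y :: "nat \<Rightarrow> complex"
  assumes "(\<lambda>i. (cmod (x i))\<^sup>2) summable_on S" "(\<lambda>i. (cmod (y i))\<^sup>2) summable_on S"
  shows "(\<lambda>i. (cmod (x i + y i))\<^sup>2) summable_on S"
proof (rule summable_on_comparison_test)
  show "(\<lambda>i. 2 * (cmod (x i))\<^sup>2 + 2 * (cmod (y i))\<^sup>2) summable_on S"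
    by (intro summable_on_add summable_on_cmult_right assms)
next
  fix i
  have "(cmod (x i + y i))\<^sup>2 \<le> (cmod (x i) + cmod (y i))\<^sup>2"
    by (simp add: norm_triangle_ineq power_mono)
  also have "\<dots> \<le> 2 * (cmod (x i))\<^sup>2 + 2 * (cmod (y i))\<^sup>2"
    using zero_le_power2[of "cmod (x i) - cmod (y i)"]
    by (simp add: power2_sum power2_diff)
  finally show "(cmod (x i + y i))\<^sup>2 \<le> 2 * (cmod (x i))\<^sup>2 + 2 * (cmod (y i))\<^sup>2" .
qed simp

instantiation ell2 :: ab_group_add
begin

lift_definition zero_ell2 :: ell2 is "\<lambda>_. 0" by simp

lift_definition plus_ell2 :: "ell2 \<Rightarrow> ell2 \<Rightarrow> ell2" is "\<lambda>x y i. x i + y i"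
  by (simp add: square_summable_add)

lift_definition uminus_ell2 :: "ell2 \<Rightarrow> ell2" is "\<lambda>x i. - x i" by simp

definition minus_ell2 :: "ell2 \<Rightarrow> ell2 \<Rightarrow> ell2" where
  "minus_ell2 x y = x + - y"

instance
  by standard (simp_all add: minus_ell2_def, (transfer; simp add: algebra_simps)+)

end

lift_definition scaleC :: "complex \<Rightarrow> ell2 \<Rightarrow> ell2" (infixr "*\<^sub>C" 75) is "\<lambda>c x i. c * x i"
  by (simp add: square_summable_scale del: norm_mult)

lift_definition cinner :: "ell2 \<Rightarrow> ell2 \<Rightarrow> complex"
  is "\<lambda>x y. \<Sum>\<^sub>\<infinity>i\<in>{1..}. x i * cnj (y i)" .

lemma coord_add [simp]: "coord (x + y) i = coord x i + coord y i"
  by transfer simp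

lemma coord_scaleC [simp]: "coord (c *\<^sub>C x) i = c * coord x i"
  by transfer simp

lemma coord_zero [simp]: "coord 0 i = 0"
  by transfer simp

lemma cinner_summable: "(\<lambda>i. coord x i * cnj (coord y i)) summable_on {1..}"
proof (rule abs_summable_summable, rule summable_on_comparison_test)
  show "(\<lambda>i. (cmod (coord x i))\<^sup>2 + (cmod (coord y i))\<^sup>2) summable_on {1..}"
    by (intro summable_on_add coord_square_summable)
next
  fix i
  have "2 * (cmod (coord x i) * cmod (coord y i)) \<le> (cmod (coord x i))\<^sup>2 + (cmod (coord y i))\<^sup>2"
    using sum_squares_bound[of "cmod (coord x i)" "cmod (coord y i)"] by (simp add: mult.assoc)
  moreover have "0 \<le> cmod (coord x i) * cmod (coord y i)" by simp
  ultimately show "norm (coord x i * cnj (coord y i)) \<le> (cmod (coord x i))\<^sup>2 + (cmod (coord y i))\<^sup>2"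
    unfolding norm_mult complex_mod_cnj by linarith
qed simp

lemma cinner_add_left: "cinner (x + y) z = cinner x z + cinner y z"
  unfolding cinner.rep_eq
  by (simp add: distrib_right infsum_add[OF cinner_summable cinner_summable] del: One_nat_def)

lemma cinner_scaleC_left: "cinner (c *\<^sub>C x) y = c * cinner x y"
  unfolding cinner.rep_eq by (simp add: mult.assoc infsum_cmult_right cinner_summable del: One_nat_def)

lemma cinner_commute: "cinner x y = cnj (cinner y x)"
  unfolding cinner.rep_eq by (simp add: infsum_cnj[symmetric] mult.commute)

lemma cinner_self: "cinner x x = of_real (\<Sum>\<^sub>\<infinity>i\<in>{1..}. (cmod (coord x i))\<^sup>2)"
  unfolding cinner.rep_eq complex_norm_square[symmetric]
  by (intro infsumI has_sum_of_real has_sum_infsum coord_square_summable)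

instantiation ell2 :: real_vector
begin

definition scaleR_ell2 :: "real \<Rightarrow> ell2 \<Rightarrow> ell2" where
  "scaleR_ell2 r x = of_real r *\<^sub>C x"

instance
  by standard (rule ell2_eqI, simp add: scaleR_ell2_def algebra_simps)+

end

text \<open>
  The library has no complex inner product spaces, so \<open>ell2\<close> becomes a \<open>real_inner\<close> space with inner product
  \<open>Re (cinner x y)\<close>; this induces the usual norm and topology.
\<close>

instantiation ell2 :: real_inner
begin

definition inner_ell2 :: "ell2 \<Rightarrow> ell2 \<Rightarrow> real" where
  "inner_ell2 x y = Re (cinner x y)"

definition norm_ell2 :: "ell2 \<Rightarrow> real" where
  "norm_ell2 x = sqrt (\<Sum>\<^sub>\<infinity>i\<in>{1..}. (cmod (coord x i))\<^sup>2)"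

definition sgn_ell2 :: "ell2 \<Rightarrow> ell2" where
  "sgn_ell2 x = x /\<^sub>R norm x"

definition dist_ell2 :: "ell2 \<Rightarrow> ell2 \<Rightarrow> real" where
  "dist_ell2 x y = norm (x - y)"

definition uniformity_ell2 :: "(ell2 \<times> ell2) filter" where
  "uniformity_ell2 = (INF e\<in>{0<..}. principal {(x, y). dist x y < e})"

definition open_ell2 :: "ell2 set \<Rightarrow> bool" where
  "open_ell2 U \<longleftrightarrow> (\<forall>x\<in>U. \<forall>\<^sub>F (x', y) in uniformity. x' = x \<longrightarrow> y \<in> U)"

instance
proof
  fix x y z :: ell2 and a :: real and U :: "ell2 set"
  show "dist x y = norm (x - y)" by (rule dist_ell2_def)
  show "sgn x = x /\<^sub>R norm x" by (rule sgn_ell2_def)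
  show "uniformity = (INF e\<in>{0<..}. principal {(x :: ell2, y). dist x y < e})"
    by (rule uniformity_ell2_def)
  show "open U \<longleftrightarrow> (\<forall>x\<in>U. \<forall>\<^sub>F (x', y) in uniformity. x' = x \<longrightarrow> y \<in> U)"
    by (rule open_ell2_def)
  show "inner x y = inner y x"
    unfolding inner_ell2_def by (subst cinner_commute) simp
  show "inner (x + y) z = inner x z + inner y z"
    by (simp add: inner_ell2_def cinner_add_left)
  show "inner (a *\<^sub>R x) y = a * inner x y"
    by (simp add: inner_ell2_def scaleR_ell2_def cinner_scaleC_left)
  show "0 \<le> inner x x"
    by (simp add: inner_ell2_def cinner_self infsum_nonneg)
  show "norm x = sqrt (inner x x)"
    by (simp add: norm_ell2_def inner_ell2_def cinner_self)
  show "inner x x = 0 \<longleftrightarrow> x = 0"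
  proof
    assume "inner x x = 0"
    then have "(\<Sum>\<^sub>\<infinity>i\<in>{1..}. (cmod (coord x i))\<^sup>2) \<le> 0"
      by (simp add: inner_ell2_def cinner_self)
    then have "\<And>i. i \<in> {1..} \<Longrightarrow> (cmod (coord x i))\<^sup>2 = 0"
      by (rule nonneg_infsum_le_0D[OF _ coord_square_summable]) auto
    then show "x = 0" by (intro ell2_eqI) simp
  qed (simp add: inner_ell2_def cinner_self)
qed

end

text \<open>The standard basis vectors are those with index \<open>i \<ge> 1\<close>; at the unused index, \<open>basis_vec 0 = 0\<close>.\<close>

lift_definition basis_vec :: "nat \<Rightarrow> ell2" is "\<lambda>i j. if 1 \<le> i \<and> j = i then 1 else 0"
proof -
  fix i :: nat
  have "(\<lambda>j. (cmod (if 1 \<le> i \<and> j = i then 1 else 0))\<^sup>2) summable_on {1..}"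
    by (rule summable_on_cong_neutral[THEN iffD1, where S1 = "{i}" and f1 = "\<lambda>j. (cmod (if 1 \<le> i \<and> j = i then 1 else 0))\<^sup>2"]) auto
  then show "(if 1 \<le> i \<and> 0 = i then 1 else 0) = (0::complex) \<and>
    (\<lambda>j. (cmod (if 1 \<le> i \<and> j = i then 1 else 0))\<^sup>2) summable_on {1..}" by auto
qed

lemma reproducing_property:
  assumes "i \<ge> 1"
  shows "cinner f (basis_vec i) = coord f i"
proof -
  have "cinner f (basis_vec i) = (\<Sum>\<^sub>\<infinity>j\<in>{i}. coord f j)"
    unfolding cinner.rep_eq basis_vec.rep_eq using assms
    by (intro infsum_cong_neutral) auto
  then show ?thesis by simp
qed

definition bounded_clinear :: "(ell2 \<Rightarrow> ell2) \<Rightarrow> bool" where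
  "bounded_clinear A \<longleftrightarrow> bounded_linear A \<and> (\<forall>c x. A (c *\<^sub>C x) = c *\<^sub>C A x)"

definition matrix_entry :: "(ell2 \<Rightarrow> ell2) \<Rightarrow> nat \<Rightarrow> nat \<Rightarrow> complex" where
  "matrix_entry A i j = cinner (A (basis_vec j)) (basis_vec i)"

definition diagonal_operator :: "(ell2 \<Rightarrow> ell2) \<Rightarrow> bool" where
  "diagonal_operator A \<longleftrightarrow> (\<forall>i\<ge>1. \<forall>j\<ge>1. i \<noteq> j \<longrightarrow> matrix_entry A i j = 0)"

definition berezin_transform :: "(ell2 \<Rightarrow> ell2) \<Rightarrow> nat \<Rightarrow> complex" where
  "berezin_transform A i = cinner (A (basis_vec i)) (basis_vec i)"

definition berezin_range :: "(ell2 \<Rightarrow> ell2) \<Rightarrow> complex set" where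
  "berezin_range A = {berezin_transform A i | i. i \<ge> 1}"

definition numerical_range :: "(ell2 \<Rightarrow> ell2) \<Rightarrow> complex set" where
  "numerical_range A = {cinner (A u) u | u. norm u = 1}"

end

theory Submission
  imports Defs
begin

text \<open>
  A bounded operator with diagonal matrix acts as \<open>(A u)\<^sub>i = d\<^sub>i u\<^sub>i\<close>, where \<open>d\<^sub>i\<close> is the
  Berezin transform at \<open>i\<close>: this is clear on the standard basis vectors, and it passes to all
  of \<open>ell2\<close> because \<open>u = \<Sum> u\<^sub>j e\<^sub>j\<close> converges in norm and \<open>A\<close> is continuous. Hence
  \<open>\<langle>A u, u\<rangle> = \<Sum> |u\<^sub>i|\<^sup>2 d\<^sub>i\<close>, and letting \<open>u\<close> run over the unit sphere gives the description of
  the numerical range by countable convex combinations (\<open>numerical_range_eq_convex_series\<close>).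

  That nothing outside the convex hull of the \<open>d\<^sub>i\<close> arises, although the hull only contains
  finite combinations and is not closed in general, is a fact about finite-dimensional spaces
  (\<open>convex_hull_image_eq_has_sum\<close>). After translating the value of the series to \<open>0\<close> and dropping
  the terms of weight zero, suppose that \<open>0 = \<Sum> w\<^sub>i q\<^sub>i\<close> with all \<open>w\<^sub>i > 0\<close>, and that
  \<open>0\<close> is not in the convex hull of the \<open>q\<^sub>i\<close>. Some nonzero vector \<open>a\<close> in the span of the \<open>q\<^sub>i\<close>
  then satisfies \<open>a \<bullet> q\<^sub>i \<ge> 0\<close> for all \<open>i\<close>. Since \<open>\<Sum> w\<^sub>i (a \<bullet> q\<^sub>i) = 0\<close>, all these inner products
  vanish, so \<open>a\<close> is orthogonal to the span that contains it, which is absurd.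
\<close>

section \<open>Convex combinations with infinitely many terms\<close>

text \<open>
  The separating functional \<open>a\<close> is chosen inside the span of the points. With only a nonzero \<open>a\<close>
  one would have to pass to the hyperplane orthogonal to \<open>a\<close> and induct on the dimension.
\<close>

lemma zero_in_convex_hull_if_has_sum:
  fixes q :: "'i \<Rightarrow> 'a::euclidean_space"
  assumes "I \<noteq> {}" and pos: "\<And>i. i \<in> I \<Longrightarrow> 0 < w i"
    and sum0: "((\<lambda>i. w i *\<^sub>R q i) has_sum 0) I"
  shows "0 \<in> convex hull (q ` I)"
proof (rule ccontr)
  assume "0 \<notin> convex hull (q ` I)"
  moreover have "convex hull (q ` I) \<noteq> {}" using \<open>I \<noteq> {}\<close> by simp
  ultimately obtain a where a: "a \<in> span (convex hull (q ` I))" "a \<noteq> 0"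
    and nonneg: "\<And>x. x \<in> convex hull (q ` I) \<Longrightarrow> 0 \<le> a \<bullet> x"
    using separating_hyperplane_set_0_inspan[OF convex_convex_hull] by metis
  have series: "((\<lambda>i. a \<bullet> (w i *\<^sub>R q i)) has_sum 0) I"
    using has_sum_bounded_linear[OF bounded_linear_inner_right sum0, of a] by simp
  have terms: "0 \<le> a \<bullet> (w i *\<^sub>R q i)" if "i \<in> I" for i
    using pos[OF that] nonneg[of "q i"] that by (simp add: hull_inc)
  have "a \<bullet> q i = 0" if "i \<in> I" for i
    using nonneg_has_sum_le_0D[OF series order_refl terms that] pos[OF that] by simp
  then have "q ` I \<subseteq> {x. a \<bullet> x = 0}" by auto
  then have "convex hull (q ` I) \<subseteq> {x. a \<bullet> x = 0}"
    by (rule hull_minimal) (rule convex_hyperplane)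
  then have "span (convex hull (q ` I)) \<subseteq> {x. a \<bullet> x = 0}"
    by (rule span_minimal) (rule subspace_hyperplane)
  with a show False by auto
qed

theorem convex_hull_image_eq_has_sum:
  fixes p :: "'i \<Rightarrow> 'a::euclidean_space"
  shows "convex hull (p ` I) =
    {s. \<exists>w. (\<forall>i\<in>I. 0 \<le> w i) \<and> (w has_sum 1) I \<and> ((\<lambda>i. w i *\<^sub>R p i) has_sum s) I}"
    (is "_ = ?R")
proof (rule antisym)
  show "convex hull (p ` I) \<subseteq> ?R"
  proof (rule hull_minimal)
    show "p ` I \<subseteq> ?R"
    proof safe
      fix k assume k: "k \<in> I"
      let ?w = "\<lambda>i. if i = k then 1 else 0 :: real"
      have "(?w has_sum 1) I" "((\<lambda>i. ?w i *\<^sub>R p i) has_sum p k) I"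
        by (rule has_sum_finite_neutralI[where B = "{k}"]; use k in simp)+
      then show "\<exists>w. (\<forall>i\<in>I. 0 \<le> w i) \<and> (w has_sum 1) I \<and> ((\<lambda>i. w i *\<^sub>R p i) has_sum p k) I"
        by (intro exI[of _ ?w]) auto
    qed
    show "convex ?R"
    proof (rule convexI)
      fix x y :: 'a and a b :: real
      assume ab: "0 \<le> a" "0 \<le> b" "a + b = 1" and "x \<in> ?R" "y \<in> ?R"
      then obtain v w where v: "\<forall>i\<in>I. 0 \<le> v i" "(v has_sum 1) I" "((\<lambda>i. v i *\<^sub>R p i) has_sum x) I"
        and w: "\<forall>i\<in>I. 0 \<le> w i" "(w has_sum 1) I" "((\<lambda>i. w i *\<^sub>R p i) has_sum y) I"
        by blast
      let ?c = "\<lambda>i. a * v i + b * w i"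
      have "\<forall>i\<in>I. 0 \<le> ?c i" using ab v(1) w(1) by simp
      moreover have "(?c has_sum 1) I"
        using has_sum_add[OF has_sum_cmult_right[OF v(2), of a] has_sum_cmult_right[OF w(2), of b]]
          ab by simp
      moreover have "((\<lambda>i. ?c i *\<^sub>R p i) has_sum a *\<^sub>R x + b *\<^sub>R y) I"
        using has_sum_add[OF has_sum_scaleR[OF v(3), of a] has_sum_scaleR[OF w(3), of b]]
        by (simp add: scaleR_add_left)
      ultimately show "a *\<^sub>R x + b *\<^sub>R y \<in> ?R"
        by (intro CollectI exI[of _ ?c] conjI)
    qed
  qed
  show "?R \<subseteq> convex hull (p ` I)"
  proof safe
    fix s w
    assume nonneg: "\<forall>i\<in>I. 0 \<le> w i" and one: "(w has_sum 1) I"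
      and s: "((\<lambda>i. w i *\<^sub>R p i) has_sum s) I"
    \<comment> \<open>The separation argument says nothing about points of weight zero, so they are dropped.\<close>
    define J where "J = {i \<in> I. 0 < w i}"
    have "((\<lambda>i. w i *\<^sub>R p i + w i *\<^sub>R - s) has_sum s + 1 *\<^sub>R - s) I"
      by (intro has_sum_add s has_sum_bounded_linear[OF bounded_linear_scaleR_left one])
    then have "((\<lambda>i. w i *\<^sub>R (p i - s)) has_sum 0) I"
      by (simp add: scaleR_diff_right)
    also have "?this \<longleftrightarrow> ((\<lambda>i. w i *\<^sub>R (p i - s)) has_sum 0) J"
      using nonneg by (intro has_sum_cong_neutral) (auto simp: J_def order_less_le)
    finally have sum0: "((\<lambda>i. w i *\<^sub>R (p i - s)) has_sum 0) J" .
    have "J \<noteq> {}"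
    proof
      assume "J = {}"
      then have "(w has_sum 0) I"
        using nonneg by (intro has_sum_0) (auto simp: J_def order_less_le)
      from has_sum_unique[OF one this] show False by simp
    qed
    with sum0 have "0 \<in> convex hull ((\<lambda>i. p i - s) ` J)"
      by (intro zero_in_convex_hull_if_has_sum[of J w]) (auto simp: J_def)
    also have "(\<lambda>i. p i - s) ` J = (\<lambda>x. - s + x) ` (p ` J)"
      by (simp add: image_image)
    finally have "s \<in> convex hull (p ` J)"
      by (auto simp only: convex_hull_translation image_iff) (simp add: add_eq_0_iff2)
    moreover have "convex hull (p ` J) \<subseteq> convex hull (p ` I)"
      by (intro hull_mono) (auto simp: J_def)
    ultimately show "s \<in> convex hull (p ` I)" by blast
  qed
qed

section \<open>Expansion in the standard basis\<close>

lemma coord_uminus [simp]: "coord (- x) i = - coord x i"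
  by transfer simp

lemma coord_diff [simp]: "coord (x - y) i = coord x i - coord y i"
  by (simp add: minus_ell2_def del: add_uminus_conv_diff)

lemma coord_scaleR [simp]: "coord (r *\<^sub>R x) i = of_real r * coord x i"
  by (simp add: scaleR_ell2_def)

lemma coord_sum: "coord (sum f F) i = (\<Sum>j\<in>F. coord (f j) i)"
  by (induction F rule: infinite_finite_induct) auto

lemma coord_basis_vec: "coord (basis_vec j) i = (if 1 \<le> j \<and> i = j then 1 else 0)"
  by transfer simp

lemma norm_power2_ell2: "(norm (x :: ell2))\<^sup>2 = (\<Sum>\<^sub>\<infinity>i\<in>{1..}. (cmod (coord x i))\<^sup>2)"
  unfolding norm_ell2_def by (simp add: infsum_nonneg)

lemma norm_coord_le: "cmod (coord x i) \<le> norm x"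
proof (cases "i \<ge> 1")
  case True
  then have "(cmod (coord x i))\<^sup>2 \<le> (norm x)\<^sup>2"
    using finite_sum_le_infsum[OF coord_square_summable[of x], of "{i}"]
    by (simp add: norm_power2_ell2)
  then show ?thesis by (rule power2_le_imp_le) simp
qed (simp add: not_le)

lemma bounded_linear_coord: "bounded_linear (\<lambda>x. coord x i)"
  by (rule bounded_linear_intro[where K = 1]) (auto simp: scaleR_conv_of_real norm_coord_le)

lemma norm_diff_partial_expansion:
  assumes "finite F" "F \<subseteq> {1..}"
  shows "(norm (u - (\<Sum>j\<in>F. coord u j *\<^sub>C basis_vec j)))\<^sup>2 = (norm u)\<^sup>2 - (\<Sum>j\<in>F. (cmod (coord u j))\<^sup>2)"
proof -
  have coords: "coord (u - (\<Sum>j\<in>F. coord u j *\<^sub>C basis_vec j)) i = (if i \<in> F then 0 else coord u i)"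
    for i
  proof -
    have "(\<Sum>j\<in>F. coord u j * coord (basis_vec j) i) = (\<Sum>j\<in>F. if j = i then coord u i else 0)"
      using assms by (intro sum.cong) (auto simp: coord_basis_vec)
    then show ?thesis using assms by (simp add: coord_sum)
  qed
  have "(norm (u - (\<Sum>j\<in>F. coord u j *\<^sub>C basis_vec j)))\<^sup>2 = (\<Sum>\<^sub>\<infinity>i\<in>{1..} - F. (cmod (coord u i))\<^sup>2)"
    unfolding norm_power2_ell2 coords by (intro infsum_cong_neutral) auto
  also have "\<dots> = (norm u)\<^sup>2 - (\<Sum>j\<in>F. (cmod (coord u j))\<^sup>2)"
    using infsum_Diff[OF coord_square_summable[of u] summable_on_finite[OF assms(1)] assms(2)]
    by (simp only: norm_power2_ell2 infsum_finite[OF assms(1)])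
  finally show ?thesis .
qed

text \<open>
  By the preceding formula, the distance from \<open>u\<close> to a partial sum is the square root of the
  mass of \<open>u\<close> outside the chosen indices, which tends to zero since \<open>u\<close> is square-summable.
\<close>

lemma basis_expansion: "((\<lambda>j. coord u j *\<^sub>C basis_vec j) has_sum u) {1..}"
proof -
  have "((\<lambda>j. (cmod (coord u j))\<^sup>2) has_sum (norm u)\<^sup>2) {1..}"
    unfolding norm_power2_ell2 by (rule has_sum_infsum[OF coord_square_summable])
  then have "((\<lambda>F. (norm u)\<^sup>2 - (\<Sum>j\<in>F. (cmod (coord u j))\<^sup>2)) \<longlongrightarrow> (norm u)\<^sup>2 - (norm u)\<^sup>2)
      (finite_subsets_at_top {1..})"
    unfolding has_sum_def by (rule tendsto_diff[OF tendsto_const])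
  then have "((\<lambda>F. sqrt ((norm u)\<^sup>2 - (\<Sum>j\<in>F. (cmod (coord u j))\<^sup>2))) \<longlongrightarrow> 0)
      (finite_subsets_at_top {1..})"
    by (auto dest: tendsto_real_sqrt)
  moreover have "\<forall>\<^sub>F F in finite_subsets_at_top {1..}.
      norm (u - (\<Sum>j\<in>F. coord u j *\<^sub>C basis_vec j)) = sqrt ((norm u)\<^sup>2 - (\<Sum>j\<in>F. (cmod (coord u j))\<^sup>2))"
    by (intro eventually_finite_subsets_at_top_weakI)
      (simp only: norm_diff_partial_expansion[symmetric] real_sqrt_abs abs_norm_cancel)
  ultimately have "((\<lambda>F. norm (u - (\<Sum>j\<in>F. coord u j *\<^sub>C basis_vec j))) \<longlongrightarrow> 0)
      (finite_subsets_at_top {1..})"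
    by (simp only: tendsto_cong)
  then show ?thesis
    unfolding has_sum_def tendsto_dist_iff[of _ u] by (simp add: dist_norm norm_minus_commute)
qed

section \<open>Diagonal operators\<close>

text \<open>
  The \<open>i\<close>-th coordinate of \<open>A u\<close> is a continuous linear function of \<open>u\<close>, so it may be computed
  term by term from the expansion of \<open>u\<close>; only the diagonal entry of row \<open>i\<close> contributes.
\<close>

lemma coord_diagonal_operator:
  assumes "bounded_clinear A" "diagonal_operator A" "i \<ge> 1"
  shows "coord (A u) i = coord u i * berezin_transform A i"
proof -
  have lin: "bounded_linear A" and A_scaleC: "\<And>c x. A (c *\<^sub>C x) = c *\<^sub>C A x"
    using assms(1) by (auto simp: bounded_clinear_def)
  have "((\<lambda>j. coord (A (coord u j *\<^sub>C basis_vec j)) i) has_sum coord (A u) i) {1..}"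
    by (rule has_sum_bounded_linear[OF bounded_linear_coord
          has_sum_bounded_linear[OF lin basis_expansion]])
  then have "((\<lambda>j. coord u j * matrix_entry A i j) has_sum coord (A u) i) {1..}"
    using assms(3) by (simp add: A_scaleC matrix_entry_def reproducing_property)
  moreover have "((\<lambda>j. coord u j * matrix_entry A i j) has_sum coord u i * matrix_entry A i i) {1..}"
    using assms(2,3)
    by (intro has_sum_finite_neutralI[where B = "{i}"]) (auto simp: diagonal_operator_def)
  ultimately have "coord (A u) i = coord u i * matrix_entry A i i"
    by (rule has_sum_unique)
  then show ?thesis by (simp only: matrix_entry_def berezin_transform_def)
qed

lemma cinner_diagonal_operator_has_sum:
  assumes "bounded_clinear A" "diagonal_operator A"
  shows "((\<lambda>i. complex_of_real ((cmod (coord u i))\<^sup>2) * berezin_transform A i)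
    has_sum cinner (A u) u) {1..}"
proof -
  have "((\<lambda>i. coord (A u) i * cnj (coord u i)) has_sum cinner (A u) u) {1..}"
    unfolding cinner.rep_eq by (rule has_sum_infsum[OF cinner_summable])
  also have "?this \<longleftrightarrow> ?thesis"
    by (intro has_sum_cong)
      (simp only: atLeast_iff coord_diagonal_operator[OF assms] complex_norm_square mult_ac)
  finally show ?thesis .
qed

lemma ex_unit_vector_coord:
  assumes "((\<lambda>i. (cmod (l i))\<^sup>2) has_sum 1) {1..}"
  obtains u where "norm u = 1" "\<And>i. i \<ge> 1 \<Longrightarrow> coord u i = l i"
proof -
  \<comment> \<open>Elements of \<open>ell2\<close> vanish at index \<open>0\<close>, where \<open>l\<close> is arbitrary.\<close>
  define x where "x i = (if i = 0 then 0 else l i)" for i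
  have sum: "((\<lambda>i. (cmod (x i))\<^sup>2) has_sum 1) {1..}"
    using assms by (rule has_sum_cong[THEN iffD1, rotated]) (simp add: x_def)
  then have coord_x: "coord (Abs_ell2 x) = x"
    by (intro Abs_ell2_inverse) (auto simp: x_def summable_on_def)
  have "norm (Abs_ell2 x) = 1"
    using infsumI[OF sum] by (simp add: norm_ell2_def coord_x)
  moreover have "coord (Abs_ell2 x) i = l i" if "i \<ge> 1" for i
    using that by (simp add: coord_x x_def)
  ultimately show ?thesis by (rule that)
qed

text \<open>
  The series is stated as a convergent one, since this is what the passage to the convex hull
  uses; its convergence comes from that of the inner product series, not from an estimate of the
  diagonal entries.
\<close>

lemma numerical_range_eq_convex_series:
  assumes "bounded_clinear A" "diagonal_operator A"
  shows "numerical_range A =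
    {s. \<exists>l :: nat \<Rightarrow> complex. ((\<lambda>i. (cmod (l i))\<^sup>2) has_sum 1) {1..} \<and>
      ((\<lambda>i. complex_of_real ((cmod (l i))\<^sup>2) * berezin_transform A i) has_sum s) {1..}}"
    (is "_ = ?R")
proof (rule antisym)
  show "numerical_range A \<subseteq> ?R"
  proof
    fix s assume "s \<in> numerical_range A"
    then obtain u where u: "norm u = 1" "s = cinner (A u) u"
      by (auto simp: numerical_range_def)
    have "((\<lambda>i. (cmod (coord u i))\<^sup>2) has_sum (norm u)\<^sup>2) {1..}"
      unfolding norm_power2_ell2 by (rule has_sum_infsum[OF coord_square_summable])
    with u cinner_diagonal_operator_has_sum[OF assms, of u] show "s \<in> ?R" by auto
  qed
  show "?R \<subseteq> numerical_range A"
  proof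
    fix s assume "s \<in> ?R"
    then obtain l where l: "((\<lambda>i. (cmod (l i))\<^sup>2) has_sum 1) {1..}"
      and s: "((\<lambda>i. complex_of_real ((cmod (l i))\<^sup>2) * berezin_transform A i) has_sum s) {1..}"
      by blast
    obtain u where u: "norm u = 1" "\<And>i. i \<ge> 1 \<Longrightarrow> coord u i = l i"
      using ex_unit_vector_coord[OF l] by blast
    have "((\<lambda>i. complex_of_real ((cmod (l i))\<^sup>2) * berezin_transform A i)
        has_sum cinner (A u) u) {1..}"
      using cinner_diagonal_operator_has_sum[OF assms, of u]
      by (rule has_sum_cong[THEN iffD1, rotated]) (simp add: u(2))
    then have "s = cinner (A u) u" using s has_sum_unique by blast
    with u(1) show "s \<in> numerical_range A" by (auto simp: numerical_range_def)
  qed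
qed

text \<open>
  Nonnegative weights are exactly the squared moduli of complex numbers, which turns these
  series into the countable convex combinations of the values of the Berezin transform.
\<close>

lemma convex_series_eq_convex_hull_berezin_range:
  "{s. \<exists>l :: nat \<Rightarrow> complex. ((\<lambda>i. (cmod (l i))\<^sup>2) has_sum 1) {1..} \<and>
      ((\<lambda>i. complex_of_real ((cmod (l i))\<^sup>2) * berezin_transform A i) has_sum s) {1..}} =
    convex hull (berezin_range A)"
    (is "?R = _")
proof -
  have "berezin_range A = berezin_transform A ` {1..}"
    by (auto simp: berezin_range_def)
  moreover have "?R = {s. \<exists>w. (\<forall>i\<in>{1..}. 0 \<le> w i) \<and> (w has_sum 1) {1..} \<and>
      ((\<lambda>i. w i *\<^sub>R berezin_transform A i) has_sum s) {1..}}" (is "_ = ?W")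
  proof (rule antisym)
    show "?R \<subseteq> ?W"
    proof safe
      fix s and l :: "nat \<Rightarrow> complex"
      assume "((\<lambda>i. (cmod (l i))\<^sup>2) has_sum 1) {1..}"
        and "((\<lambda>i. complex_of_real ((cmod (l i))\<^sup>2) * berezin_transform A i) has_sum s) {1..}"
      then show "\<exists>w. (\<forall>i\<in>{1..}. 0 \<le> w i) \<and> (w has_sum 1) {1..} \<and>
          ((\<lambda>i. w i *\<^sub>R berezin_transform A i) has_sum s) {1..}"
        by (intro exI[of _ "\<lambda>i. (cmod (l i))\<^sup>2"]) (simp add: scaleR_conv_of_real)
    qed
    show "?W \<subseteq> ?R"
    proof safe
      fix s and w :: "nat \<Rightarrow> real"
      assume w: "\<forall>i\<in>{1..}. 0 \<le> w i" "(w has_sum 1) {1..}"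
        "((\<lambda>i. w i *\<^sub>R berezin_transform A i) has_sum s) {1..}"
      let ?l = "\<lambda>i. complex_of_real (sqrt (w i))"
      have sq: "(cmod (?l i))\<^sup>2 = w i" if "i \<in> {1..}" for i
        using w(1) that by simp
      have "((\<lambda>i. (cmod (?l i))\<^sup>2) has_sum 1) {1..}"
        using w(2) by (rule has_sum_cong[THEN iffD1, rotated]) (rule sq[symmetric])
      moreover have "((\<lambda>i. complex_of_real ((cmod (?l i))\<^sup>2) * berezin_transform A i) has_sum s) {1..}"
        using w(3) by (rule has_sum_cong[THEN iffD1, rotated])
          (simp only: sq scaleR_conv_of_real)
      ultimately show "\<exists>l. ((\<lambda>i. (cmod (l i))\<^sup>2) has_sum 1) {1..} \<and>
          ((\<lambda>i. complex_of_real ((cmod (l i))\<^sup>2) * berezin_transform A i) has_sum s) {1..}"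
        by (intro exI[of _ ?l] conjI)
    qed
  qed
  ultimately show ?thesis by (simp only: convex_hull_image_eq_has_sum)
qed

theorem theorem5p5:
  fixes A :: "ell2 \<Rightarrow> ell2"
  assumes "bounded_clinear A" and "diagonal_operator A"
  shows "numerical_range A = convex hull (berezin_range A) \<and>
    numerical_range A =
      {(\<Sum>\<^sub>\<infinity>i\<in>{1..}. complex_of_real ((cmod (l i))\<^sup>2) * berezin_transform A i) | l :: nat \<Rightarrow> complex.
        ((\<lambda>i. (cmod (l i))\<^sup>2) has_sum 1) {1..}}"
proof
  note W = numerical_range_eq_convex_series[OF assms]
  show "numerical_range A = convex hull (berezin_range A)"
    unfolding W by (rule convex_series_eq_convex_hull_berezin_range)
  have summable: "(\<lambda>i. complex_of_real ((cmod (l i))\<^sup>2) * berezin_transform A i) summable_on {1..}"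
    if l: "((\<lambda>i. (cmod (l i))\<^sup>2) has_sum 1) {1..}" for l :: "nat \<Rightarrow> complex"
  proof -
    obtain u where u: "norm u = 1" "\<And>i. i \<ge> 1 \<Longrightarrow> coord u i = l i"
      using ex_unit_vector_coord[OF l] by blast
    have "(\<lambda>i. complex_of_real ((cmod (coord u i))\<^sup>2) * berezin_transform A i) summable_on {1..}"
      using cinner_diagonal_operator_has_sum[OF assms, of u] by (auto simp: summable_on_def)
    then show ?thesis
      by (rule summable_on_cong[THEN iffD1, rotated]) (simp add: u(2))
  qed
  show "numerical_range A =
      {(\<Sum>\<^sub>\<infinity>i\<in>{1..}. complex_of_real ((cmod (l i))\<^sup>2) * berezin_transform A i) | l :: nat \<Rightarrow> complex.
        ((\<lambda>i. (cmod (l i))\<^sup>2) has_sum 1) {1..}}"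
    unfolding W has_sum_iff[of "\<lambda>i. _ i * berezin_transform A i"] using summable by blast
qed

end
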